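(* Let $a\neq0$ be a real number, let $(Z_i)_{i\ge1}$ be i.i.d. standard normal random variables and, for $n\ge2$, let $$U_n=\frac{2a}{n(n-1)}\sum_{1\le i<j\le n}Z_iZ_j .$$ Then there is a constant $C$, independent of $n$, such that for any $n\ge3$, $$\mathbf{W}_2\big(nU_n,\,a(Z_1^2-1)\big)\le C\left(a^2\sqrt{\frac{n(n-3)}{(n-1)^3}}+\frac{2a^2}{n-1}\right).$$ Namely, for $n$ large enough, $\mathbf{W}_2\big(nU_n,\,a(Z_1^2-1)\big)=\mathcal{O}\big(1/\sqrt n\big)$.
   Context: $\mathbf{W}_2(F,G)=(\inf \mathbb{E}|X-Y|^2)^{1/2}$, the infimum being over all couplings $(X,Y)$ with $X\sim F$, $Y\sim G$ in law. The constant $C$ may depend on the target law $a(Z_1^2-1)$ (hence on $a$). *)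

theory Defs
  imports "HOL-Probability.Probability" "HOL-Library.Landau_Symbols"
begin

(* A coupling (X, Y) of F and G enters only through its joint law, a probability measure on the
   plane. The marginal equations compare whole measures, so they force sets F = sets borel and
   sets G = sets borel. *)
definition couplings :: "real measure \<Rightarrow> real measure \<Rightarrow> (real \<times> real) measure set" where
  "couplings F G = {\<pi>. prob_space \<pi> \<and> sets \<pi> = sets (borel \<Otimes>\<^sub>M borel)
      \<and> distr \<pi> borel fst = F \<and> distr \<pi> borel snd = G}"

definition W2_sq :: "real measure \<Rightarrow> real measure \<Rightarrow> ennreal" where
  "W2_sq F G = (\<Sqinter>\<pi>\<in>couplings F G. \<integral>\<^sup>+ (x, y). ennreal (\<bar>x - y\<bar>\<^sup>2) \<partial>\<pi>)"

(* Square root extended by sqrt \<infinity> = \<infinity>, so that an infinite transport cost stays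
   infinite instead of being sent to 0 by enn2real. *)
definition W2 :: "real measure \<Rightarrow> real measure \<Rightarrow> ennreal" where
  "W2 F G = (if W2_sq F G = \<infinity> then \<infinity> else ennreal (sqrt (enn2real (W2_sq F G))))"

(* The sequence Z is indexed from 1. *)
definition U_stat :: "real \<Rightarrow> (nat \<Rightarrow> 'a \<Rightarrow> real) \<Rightarrow> nat \<Rightarrow> 'a \<Rightarrow> real" where
  "U_stat a Z n \<omega> = 2 * a / (real n * (real n - 1)) *
      (\<Sum>(i, j)\<in>{(i, j). 1 \<le> i \<and> i < j \<and> j \<le> n}. Z i \<omega> * Z j \<omega>)"

end

theory Submission
  imports Defs
begin

text \<open>
  Write \<open>S = (Z\<^sub>1 + \<dots> + Z\<^sub>n) / \<surd>n\<close>.  Squaring the sum turns the \<open>U\<close>-statistic into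
  \<open>n U\<^sub>n = a / (n - 1) \<cdot> (n S\<^sup>2 - \<Sum> Z\<^sub>i\<^sup>2)\<close>, hence
  \<open>n U\<^sub>n - a (S\<^sup>2 - 1) = a / (n - 1) \<cdot> ((S\<^sup>2 - 1) - \<Sum> (Z\<^sub>i\<^sup>2 - 1))\<close>.
  Since \<open>S\<close> is again standard normal, \<open>a (S\<^sup>2 - 1)\<close> has the target law, so the pair
  \<open>(n U\<^sub>n, a (S\<^sup>2 - 1))\<close> is an explicit coupling, and its cost bounds \<open>W\<^sub>2\<^sup>2\<close> from above.  This
  cost is controlled by the variance \<open>2\<close> of a centred squared normal
  variable: the sum of \<open>n\<close> independent ones has second moment \<open>2n\<close>, and
  \<open>(u - v)\<^sup>2 \<le> 2u\<^sup>2 + 2v\<^sup>2\<close> yields the cost bound \<open>4 (n + 1) a\<^sup>2 / (n - 1)\<^sup>2\<close>, which for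
  \<open>n \<ge> 3\<close> is at most \<open>8 a\<^sup>2 / (n - 1)\<close> (lemma \<open>W2_U_stat_le\<close>).

  Both claims follow by comparing \<open>\<bar>a\<bar> \<surd>(8 / (n - 1))\<close> with the stated rates.
  The right-hand side of the first one is of the same order \<open>1 / \<surd>n\<close> but quadratic in \<open>a\<close>,
  whereas the distance scales like \<open>\<bar>a\<bar>\<close>; this is why the constant is proportional to
  \<open>1 / \<bar>a\<bar>\<close>.
\<close>

section \<open>Upper bounds on the Wasserstein distance from couplings\<close>

text \<open>
  Two random variables on a common space have a joint law, and this is one of the couplings over
  which the infimum is taken.
\<close>

lemma (in prob_space) W2_sq_distr_le:
  assumes [measurable]: "X \<in> borel_measurable M" "Y \<in> borel_measurable M"
  shows "W2_sq (distr M borel X) (distr M borel Y) \<le> (\<integral>\<^sup>+\<omega>. ennreal ((X \<omega> - Y \<omega>)\<^sup>2) \<partial>M)"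
proof -
  let ?\<pi> = "distr M (borel \<Otimes>\<^sub>M borel) (\<lambda>\<omega>. (X \<omega>, Y \<omega>))"
  have "?\<pi> \<in> couplings (distr M borel X) (distr M borel Y)"
    by (auto simp: couplings_def distr_distr comp_def intro!: prob_space_distr)
  then have "W2_sq (distr M borel X) (distr M borel Y)
      \<le> (\<integral>\<^sup>+ (x, y). ennreal (\<bar>x - y\<bar>\<^sup>2) \<partial>?\<pi>)"
    unfolding W2_sq_def by (rule INF_lower)
  also have "\<dots> = (\<integral>\<^sup>+\<omega>. ennreal ((X \<omega> - Y \<omega>)\<^sup>2) \<partial>M)"
    by (subst nn_integral_distr) auto
  finally show ?thesis .
qed

lemma (in prob_space) W2_distr_le:
  assumes "X \<in> borel_measurable M" "Y \<in> borel_measurable M"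
    and int: "integrable M (\<lambda>\<omega>. (X \<omega> - Y \<omega>)\<^sup>2)"
    and le: "expectation (\<lambda>\<omega>. (X \<omega> - Y \<omega>)\<^sup>2) \<le> c"
  shows "W2 (distr M borel X) (distr M borel Y) \<le> ennreal (sqrt c)"
proof -
  let ?W = "W2_sq (distr M borel X) (distr M borel Y)"
  have "0 \<le> expectation (\<lambda>\<omega>. (X \<omega> - Y \<omega>)\<^sup>2)"
    by simp
  with le have c: "0 \<le> c"
    by linarith
  have "?W \<le> (\<integral>\<^sup>+\<omega>. ennreal ((X \<omega> - Y \<omega>)\<^sup>2) \<partial>M)"
    using assms(1,2) by (rule W2_sq_distr_le)
  also have "\<dots> = ennreal (expectation (\<lambda>\<omega>. (X \<omega> - Y \<omega>)\<^sup>2))"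
    by (rule nn_integral_eq_integral[OF int]) simp
  finally have W: "?W \<le> ennreal c"
    using le by (meson ennreal_leI order_trans)
  then have "enn2real ?W \<le> c" "?W \<noteq> \<infinity>"
    using c by (auto intro: enn2real_leI simp: top_unique)
  then show ?thesis
    by (simp add: W2_def ennreal_leI)
qed

section \<open>Second moments of sums and of centred squares\<close>

text \<open>The mixed terms of the expanded square vanish by independence and centring.\<close>

lemma (in prob_space)
  fixes Y :: "'i \<Rightarrow> 'a \<Rightarrow> real"
  assumes fin: "finite I" and indep: "indep_vars (\<lambda>_. borel) Y I"
    and sq: "\<And>i. i \<in> I \<Longrightarrow> integrable M (\<lambda>\<omega>. (Y i \<omega>)\<^sup>2)"
    and centred: "\<And>i. i \<in> I \<Longrightarrow> expectation (Y i) = 0"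
  shows integrable_square_sum_indep: "integrable M (\<lambda>\<omega>. (\<Sum>i\<in>I. Y i \<omega>)\<^sup>2)"
    and expectation_square_sum_indep:
      "expectation (\<lambda>\<omega>. (\<Sum>i\<in>I. Y i \<omega>)\<^sup>2) = (\<Sum>i\<in>I. expectation (\<lambda>\<omega>. (Y i \<omega>)\<^sup>2))"
proof -
  have int: "integrable M (Y i)" if "i \<in> I" for i
  proof (rule square_integrable_imp_integrable)
    show "Y i \<in> borel_measurable M"
      using indep that by (auto simp: indep_vars_def)
  qed (use sq that in auto)
  have off: "integrable M (\<lambda>\<omega>. Y i \<omega> * Y j \<omega>) \<and> expectation (\<lambda>\<omega>. Y i \<omega> * Y j \<omega>) = 0"
    if "i \<in> I" "j \<in> I" "i \<noteq> j" for i j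
  proof -
    have "indep_vars (\<lambda>_. borel) Y {i, j}"
      using indep that by (rule_tac indep_vars_subset) auto
    from indep_vars_integrable[OF _ this] indep_vars_lebesgue_integral[OF _ this]
    show ?thesis
      using that int centred by auto
  qed
  have mul: "integrable M (\<lambda>\<omega>. Y i \<omega> * Y j \<omega>)"
    "expectation (\<lambda>\<omega>. Y i \<omega> * Y j \<omega>) = (if i = j then expectation (\<lambda>\<omega>. (Y i \<omega>)\<^sup>2) else 0)"
    if "i \<in> I" "j \<in> I" for i j
    using off[OF that] sq[OF that(1)] by (auto simp: power2_eq_square)
  have eq: "(\<Sum>i\<in>I. Y i \<omega>)\<^sup>2 = (\<Sum>i\<in>I. \<Sum>j\<in>I. Y i \<omega> * Y j \<omega>)" for \<omega>
    by (simp add: power2_eq_square sum_product)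
  show "integrable M (\<lambda>\<omega>. (\<Sum>i\<in>I. Y i \<omega>)\<^sup>2)"
    unfolding eq by (intro Bochner_Integration.integrable_sum mul)
  show "expectation (\<lambda>\<omega>. (\<Sum>i\<in>I. Y i \<omega>)\<^sup>2) = (\<Sum>i\<in>I. expectation (\<lambda>\<omega>. (Y i \<omega>)\<^sup>2))"
    unfolding eq using fin by (simp add: mul Bochner_Integration.integral_sum)
qed

lemma (in prob_space)
  assumes X: "distributed M lborel X std_normal_density"
  shows integrable_std_normal_power: "integrable M (\<lambda>\<omega>. X \<omega> ^ k)"
    and expectation_std_normal_power_even:
      "expectation (\<lambda>\<omega>. X \<omega> ^ (2 * k)) = fact (2 * k) / (2 ^ k * fact k)"
proof -
  show "integrable M (\<lambda>\<omega>. X \<omega> ^ k)"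
    using distributed_integrable[OF X, of "\<lambda>x. x ^ k"] integrable_std_normal_moment by auto
  show "expectation (\<lambda>\<omega>. X \<omega> ^ (2 * k)) = fact (2 * k) / (2 ^ k * fact k)"
    using distributed_integral[OF X, of "\<lambda>x. x ^ (2 * k)"] integral_std_normal_moment_even by auto
qed

lemma (in prob_space)
  assumes X: "distributed M lborel X std_normal_density"
  shows expectation_centred_square_std_normal: "expectation (\<lambda>\<omega>. (X \<omega>)\<^sup>2 - 1) = 0"
    and integrable_square_centred_square_std_normal: "integrable M (\<lambda>\<omega>. ((X \<omega>)\<^sup>2 - 1)\<^sup>2)"
    and variance_square_std_normal: "expectation (\<lambda>\<omega>. ((X \<omega>)\<^sup>2 - 1)\<^sup>2) = 2"
proof -
  note int = integrable_std_normal_power[OF X]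
  note ev = expectation_std_normal_power_even[OF X]
  have m2: "expectation (\<lambda>\<omega>. (X \<omega>)\<^sup>2) = 1"
    using ev[of 1] by simp
  have m4: "expectation (\<lambda>\<omega>. X \<omega> ^ 4) = 3"
    using ev[of 2] by (simp add: fact_numeral)
  show "expectation (\<lambda>\<omega>. (X \<omega>)\<^sup>2 - 1) = 0"
    using int m2 by (simp add: prob_space)
  have eq: "((X \<omega>)\<^sup>2 - 1)\<^sup>2 = X \<omega> ^ 4 - 2 * (X \<omega>)\<^sup>2 + 1" for \<omega>
    by (simp add: power2_eq_square power4_eq_xxxx algebra_simps)
  show "integrable M (\<lambda>\<omega>. ((X \<omega>)\<^sup>2 - 1)\<^sup>2)"
    unfolding eq using int by simp
  show "expectation (\<lambda>\<omega>. ((X \<omega>)\<^sup>2 - 1)\<^sup>2) = 2"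
    unfolding eq using int m2 m4 by (simp add: prob_space)
qed

lemma (in prob_space) std_normal_normalized_sum:
  assumes "finite I" "I \<noteq> {}" and indep: "indep_vars (\<lambda>_. borel) X I"
    and X: "\<And>i. i \<in> I \<Longrightarrow> distributed M lborel (X i) std_normal_density"
  shows "distributed M lborel (\<lambda>\<omega>. (\<Sum>i\<in>I. X i \<omega>) / sqrt (real (card I))) std_normal_density"
proof -
  have "0 < card I"
    using assms(1,2) by (simp add: card_gt_0_iff)
  then have pos: "0 < sqrt (real (card I))"
    by simp
  have "distributed M lborel (\<lambda>\<omega>. \<Sum>i\<in>I. X i \<omega>)
      (normal_density (\<Sum>i\<in>I. 0) (sqrt (\<Sum>i\<in>I. 1\<^sup>2)))"
    by (rule sum_indep_normal[OF assms(1,2) indep _ X]) simp_all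
  then have "distributed M lborel (\<lambda>\<omega>. \<Sum>i\<in>I. X i \<omega>) (normal_density 0 (sqrt (real (card I))))"
    by simp
  from this[unfolded normal_standard_normal_convert[OF pos, of _ 0]] show ?thesis
    by simp
qed

section \<open>The coupling with the normalized sum\<close>

lemma square_sum_eq_squares_plus_pairs:
  fixes z :: "nat \<Rightarrow> 'b::comm_ring_1"
  shows "(\<Sum>i=1..n. z i)\<^sup>2
    = (\<Sum>i=1..n. (z i)\<^sup>2) + 2 * (\<Sum>(i, j)\<in>{(i, j). 1 \<le> i \<and> i < j \<and> j \<le> n}. z i * z j)"
proof (induction n)
  case 0
  have "{(i, j). 1 \<le> i \<and> i < j \<and> j \<le> (0::nat)} = {}"
    by auto
  then show ?case
    by (simp only: sum.empty) simp
next
  case (Suc n)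
  let ?P = "\<lambda>n. {(i, j). 1 \<le> i \<and> i < j \<and> j \<le> n}"
  have split: "?P (Suc n) = ?P n \<union> {1..n} \<times> {Suc n}"
    by auto
  have "finite (?P n)"
    by (rule finite_subset[of _ "{1..n} \<times> {1..n}"]) auto
  then have "(\<Sum>(i, j)\<in>?P (Suc n). z i * z j)
      = (\<Sum>(i, j)\<in>?P n. z i * z j) + (\<Sum>(i, j)\<in>{1..n} \<times> {Suc n}. z i * z j)"
    unfolding split by (intro sum.union_disjoint) auto
  also have "(\<Sum>(i, j)\<in>{1..n} \<times> {Suc n}. z i * z j) = (\<Sum>i=1..n. z i) * z (Suc n)"
    by (simp add: sum.cartesian_product[symmetric] sum_distrib_right)
  finally show ?case
    using Suc by (simp add: power2_eq_square algebra_simps)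
qed

lemma U_stat_minus_centred_square:
  fixes Z :: "nat \<Rightarrow> 'a \<Rightarrow> real"
  assumes n: "n \<ge> 2"
  defines "S \<equiv> \<lambda>\<omega>. (\<Sum>i=1..n. Z i \<omega>) / sqrt (real n)"
  shows "real n * U_stat a Z n \<omega> - a * ((S \<omega>)\<^sup>2 - 1)
    = a / (real n - 1) * (((S \<omega>)\<^sup>2 - 1) - (\<Sum>i=1..n. (Z i \<omega>)\<^sup>2 - 1))"
proof -
  have S: "(\<Sum>i=1..n. Z i \<omega>)\<^sup>2 = real n * (S \<omega>)\<^sup>2"
    using n by (simp add: S_def power_divide)
  have "real n * U_stat a Z n \<omega> = a / (real n - 1) *
      (2 * (\<Sum>(i, j)\<in>{(i, j). 1 \<le> i \<and> i < j \<and> j \<le> n}. Z i \<omega> * Z j \<omega>))"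
    using n by (simp add: U_stat_def field_simps)
  also have "2 * (\<Sum>(i, j)\<in>{(i, j). 1 \<le> i \<and> i < j \<and> j \<le> n}. Z i \<omega> * Z j \<omega>)
      = real n * (S \<omega>)\<^sup>2 - (\<Sum>i=1..n. (Z i \<omega>)\<^sup>2)"
    using square_sum_eq_squares_plus_pairs[of "\<lambda>i. Z i \<omega>" n] unfolding S by linarith
  finally show ?thesis
    using n by (simp add: sum_subtractf field_simps)
qed

text \<open>
  The proof pairs the statistic with \<open>a (S\<^sup>2 - 1)\<close> rather than with \<open>a (Z\<^sub>1\<^sup>2 - 1)\<close>:
  the two have equal laws, but only the former is close to the statistic pointwise.
  The constant \<open>8\<close> is not sharp: \<open>\<Sum> Z\<^sub>i\<^sup>2 - S\<^sup>2\<close> is chi-squared with \<open>n - 1\<close> degrees of freedom,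
  so the exact cost of this coupling is \<open>2 a\<^sup>2 / (n - 1)\<close>.  Bounding the terms \<open>S\<^sup>2 - 1\<close> and
  \<open>\<Sum> (Z\<^sub>i\<^sup>2 - 1)\<close> separately loses only a constant factor.
\<close>

lemma (in prob_space) W2_U_stat_le:
  assumes indep: "indep_vars (\<lambda>_. borel) Z {1..}"
    and Z: "\<And>i. 1 \<le> i \<Longrightarrow> distributed M lborel (Z i) std_normal_density"
    and n: "n \<ge> 3"
  shows "W2 (distr M borel (\<lambda>\<omega>. real n * U_stat a Z n \<omega>))
            (distr M borel (\<lambda>\<omega>. a * ((Z 1 \<omega>)\<^sup>2 - 1)))
    \<le> ennreal (\<bar>a\<bar> * sqrt (8 / (real n - 1)))"
proof -
  define S where "S \<omega> = (\<Sum>i=1..n. Z i \<omega>) / sqrt (real n)" for \<omega>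
  define R where "R \<omega> = (\<Sum>i=1..n. (Z i \<omega>)\<^sup>2 - 1)" for \<omega>
  define D where "D \<omega> = real n * U_stat a Z n \<omega> - a * ((S \<omega>)\<^sup>2 - 1)" for \<omega>
  define b where "b = a / (real n - 1)"
  have D: "D \<omega> = b * (((S \<omega>)\<^sup>2 - 1) - R \<omega>)" for \<omega>
    using U_stat_minus_centred_square[of n a Z \<omega>] n by (simp add: D_def S_def R_def b_def)

  have indep_n: "indep_vars (\<lambda>_. borel) Z {1..n}"
    using indep by (rule indep_vars_subset) auto
  have meas_Z [measurable]: "Z i \<in> borel_measurable M" if "1 \<le> i" for i
    using distributed_measurable[OF Z[OF that]] by simp
  have meas_S [measurable]: "S \<in> borel_measurable M"
    unfolding S_def by simp
  have meas_R [measurable]: "R \<in> borel_measurable M"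
    unfolding R_def by simp
  have meas_U [measurable]: "(\<lambda>\<omega>. real n * U_stat a Z n \<omega>) \<in> borel_measurable M"
  proof -
    have "(\<lambda>\<omega>. D \<omega> + a * ((S \<omega>)\<^sup>2 - 1)) \<in> borel_measurable M"
      unfolding D by measurable
    then show ?thesis
      by (simp add: D_def)
  qed

  have S: "distributed M lborel S std_normal_density"
    using std_normal_normalized_sum[OF _ _ indep_n] Z n by (simp add: S_def[abs_def])
  have law: "distr M borel (\<lambda>\<omega>. a * ((Z 1 \<omega>)\<^sup>2 - 1)) = distr M borel (\<lambda>\<omega>. a * ((S \<omega>)\<^sup>2 - 1))"
  proof -
    have "distr M lborel (Z 1) = distr M lborel S"
      using distributed_distr_eq_density[OF S] distributed_distr_eq_density[OF Z[of 1]] by simp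
    then have "distr (distr M lborel (Z 1)) borel (\<lambda>x. a * (x\<^sup>2 - 1))
        = distr (distr M lborel S) borel (\<lambda>x. a * (x\<^sup>2 - 1))"
      by simp
    then show ?thesis
      by (simp add: distr_distr comp_def)
  qed

  note Z_sq = expectation_centred_square_std_normal[OF Z]
    integrable_square_centred_square_std_normal[OF Z] variance_square_std_normal[OF Z]
  have indep_sq: "indep_vars (\<lambda>_. borel) (\<lambda>i \<omega>. (Z i \<omega>)\<^sup>2 - 1) {1..n}"
    by (rule indep_vars_compose2[OF indep_n]) simp
  have int_R: "integrable M (\<lambda>\<omega>. (R \<omega>)\<^sup>2)"
    unfolding R_def by (rule integrable_square_sum_indep[OF _ indep_sq]) (use Z_sq in auto)
  have "expectation (\<lambda>\<omega>. (R \<omega>)\<^sup>2) = (\<Sum>i=1..n. expectation (\<lambda>\<omega>. ((Z i \<omega>)\<^sup>2 - 1)\<^sup>2))"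
    unfolding R_def by (rule expectation_square_sum_indep[OF _ indep_sq]) (use Z_sq in auto)
  then have exp_R: "expectation (\<lambda>\<omega>. (R \<omega>)\<^sup>2) = 2 * real n"
    using Z_sq(3) by simp
  note int_S = integrable_square_centred_square_std_normal[OF S]
  note exp_S = variance_square_std_normal[OF S]

  let ?B = "\<lambda>\<omega>. b\<^sup>2 * (2 * ((S \<omega>)\<^sup>2 - 1)\<^sup>2 + 2 * (R \<omega>)\<^sup>2)"
  have D_le: "(D \<omega>)\<^sup>2 \<le> ?B \<omega>" for \<omega>
  proof -
    have "(u - v)\<^sup>2 \<le> 2 * u\<^sup>2 + 2 * v\<^sup>2" for u v :: real
      using zero_le_power2[of "u + v"] by (simp add: power2_eq_square algebra_simps)
    then show ?thesis
      unfolding D power_mult_distrib by (intro mult_left_mono) auto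
  qed
  have int_B: "integrable M ?B"
    using int_S int_R by simp
  have int_D: "integrable M (\<lambda>\<omega>. (D \<omega>)\<^sup>2)"
  proof (rule Bochner_Integration.integrable_bound[OF int_B])
    show "(\<lambda>\<omega>. (D \<omega>)\<^sup>2) \<in> borel_measurable M"
      unfolding D by measurable
    show "AE \<omega> in M. norm ((D \<omega>)\<^sup>2) \<le> norm (?B \<omega>)"
      using D_le by (auto intro: order_trans[OF _ abs_ge_self])
  qed
  have "expectation (\<lambda>\<omega>. (D \<omega>)\<^sup>2) \<le> expectation ?B"
    using D_le by (intro integral_mono int_D int_B)
  also have "\<dots> = b\<^sup>2 * (4 * (real n + 1))"
    using int_S int_R exp_S exp_R by simp
  also have "\<dots> \<le> b\<^sup>2 * (8 * (real n - 1))"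
    using n by (intro mult_left_mono) auto
  also have "\<dots> = a\<^sup>2 * (8 / (real n - 1))"
    using n by (simp add: b_def power2_eq_square divide_simps)
  finally have "W2 (distr M borel (\<lambda>\<omega>. real n * U_stat a Z n \<omega>))
      (distr M borel (\<lambda>\<omega>. a * ((S \<omega>)\<^sup>2 - 1))) \<le> ennreal (sqrt (a\<^sup>2 * (8 / (real n - 1))))"
    using int_D unfolding D_def by (intro W2_distr_le) auto
  then show ?thesis
    unfolding law by (simp only: real_sqrt_mult real_sqrt_abs)
qed

section \<open>Comparison with the stated rate\<close>

text \<open>
  For \<open>n = 3\<close> the square root on the right vanishes and the summand \<open>2 / (n - 1)\<close> has to carry
  the bound.  From \<open>n = 4\<close> on the square root suffices, because
  \<open>n (n - 3) / (n - 1)\<^sup>2 \<ge> 4 / 9\<close>, with equality at \<open>n = 4\<close>; the factor \<open>5\<close> is a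
  round number above \<open>(3 / 2) \<surd>8\<close>.
\<close>

lemma sqrt_inverse_le_U_stat_rate:
  assumes n: "n \<ge> 3"
  shows "sqrt (8 / (real n - 1))
    \<le> 5 * (sqrt (real n * (real n - 3) / (real n - 1) ^ 3) + 2 / (real n - 1))"
proof (cases "n = 3")
  case True
  then show ?thesis
    by (simp add: real_le_lsqrt)
next
  case False
  with n have n4: "real n \<ge> 4"
    by simp
  have "0 \<le> (real n - 4) * (5 * real n + 1)"
    using n4 by simp
  then have "4 / 9 * (real n - 1)\<^sup>2 \<le> real n * (real n - 3)"
    by (simp add: power2_eq_square field_simps)
  then have "4 / 9 * (real n - 1)\<^sup>2 / (real n - 1) ^ 3 \<le> real n * (real n - 3) / (real n - 1) ^ 3"
    using n4 by (intro divide_right_mono) auto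
  moreover have "4 / 9 * (real n - 1)\<^sup>2 / (real n - 1) ^ 3 = 4 / 9 / (real n - 1)"
  proof -
    have "c * m\<^sup>2 / m ^ 3 = c / m" if "m \<noteq> 0" for c m :: real
      using that by (simp add: power2_eq_square power3_eq_cube)
    from this[of "real n - 1" "4 / 9"] show ?thesis
      using n4 by linarith
  qed
  ultimately have "25 * (4 / 9 / (real n - 1)) \<le> 25 * (real n * (real n - 3) / (real n - 1) ^ 3)"
    by simp
  moreover have "8 / (real n - 1) \<le> 25 * (4 / 9 / (real n - 1))"
    using n4 by (simp add: divide_simps)
  ultimately have "sqrt (8 / (real n - 1))
      \<le> sqrt (25 * (real n * (real n - 3) / (real n - 1) ^ 3))"
    by (intro real_sqrt_le_mono) linarith
  also have "\<dots> = 5 * sqrt (real n * (real n - 3) / (real n - 1) ^ 3)"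
    using real_sqrt_abs[of 5] by (simp only: real_sqrt_mult) simp
  also have "\<dots> \<le> 5 * (sqrt (real n * (real n - 3) / (real n - 1) ^ 3) + 2 / (real n - 1))"
    using n4 by simp
  finally show ?thesis .
qed

theorem corollary3p1:
  fixes M :: "'a measure" and Z :: "nat \<Rightarrow> 'a \<Rightarrow> real" and a :: real
  assumes "prob_space M"
    and "prob_space.indep_vars M (\<lambda>_. borel) Z {1..}"
    and "\<And>i. 1 \<le> i \<Longrightarrow> distributed M lborel (Z i) std_normal_density"
    and "a \<noteq> 0"
  shows "(\<exists>C>0. \<forall>n\<ge>3.
            W2 (distr M borel (\<lambda>\<omega>. real n * U_stat a Z n \<omega>))
               (distr M borel (\<lambda>\<omega>. a * ((Z 1 \<omega>)\<^sup>2 - 1)))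
            \<le> ennreal (C * (a\<^sup>2 * sqrt (real n * (real n - 3) / (real n - 1) ^ 3)
                              + 2 * a\<^sup>2 / (real n - 1))))
       \<and> (\<lambda>n. enn2real (W2 (distr M borel (\<lambda>\<omega>. real n * U_stat a Z n \<omega>))
                             (distr M borel (\<lambda>\<omega>. a * ((Z 1 \<omega>)\<^sup>2 - 1)))))
         \<in> O(\<lambda>n. 1 / sqrt (real n))"
proof -
  interpret prob_space M
    by fact
  let ?W = "\<lambda>n. W2 (distr M borel (\<lambda>\<omega>. real n * U_stat a Z n \<omega>))
               (distr M borel (\<lambda>\<omega>. a * ((Z 1 \<omega>)\<^sup>2 - 1)))"
  have W: "?W n \<le> ennreal (\<bar>a\<bar> * sqrt (8 / (real n - 1)))" if "n \<ge> 3" for n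
    using assms(2,3) that by (rule W2_U_stat_le)
  have rate: "?W n \<le> ennreal (5 / \<bar>a\<bar> * (a\<^sup>2 * sqrt (real n * (real n - 3) / (real n - 1) ^ 3)
      + 2 * a\<^sup>2 / (real n - 1)))" if n: "n \<ge> 3" for n
  proof -
    have "\<bar>a\<bar> * sqrt (8 / (real n - 1))
        \<le> \<bar>a\<bar> * (5 * (sqrt (real n * (real n - 3) / (real n - 1) ^ 3) + 2 / (real n - 1)))"
      by (intro mult_left_mono sqrt_inverse_le_U_stat_rate n) simp
    also have "\<dots> = 5 / \<bar>a\<bar> * (\<bar>a\<bar>\<^sup>2 * sqrt (real n * (real n - 3) / (real n - 1) ^ 3)
        + 2 * \<bar>a\<bar>\<^sup>2 / (real n - 1))"
    proof -
      have "c * (5 * (s + 2 / m)) = 5 / c * (c\<^sup>2 * s + 2 * c\<^sup>2 / m)" if "c \<noteq> 0" for c s m :: real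
        using that by (simp add: power2_eq_square distrib_left)
      then show ?thesis
        using \<open>a \<noteq> 0\<close> by simp
    qed
    finally show ?thesis
      using W[OF n] by (auto intro: order_trans ennreal_leI)
  qed
  have "(\<lambda>n. enn2real (?W n)) \<in> O(\<lambda>n. 1 / sqrt (real n))"
  proof (rule bigoI[where c = "4 * \<bar>a\<bar>"], use eventually_ge_at_top[of 3] in eventually_elim)
    fix n :: nat
    assume n: "n \<ge> 3"
    then have "8 / (real n - 1) \<le> 16 / real n"
      by (simp add: divide_simps)
    then have "sqrt (8 / (real n - 1)) \<le> sqrt (16 / real n)"
      by (rule real_sqrt_le_mono)
    then have "\<bar>a\<bar> * sqrt (8 / (real n - 1)) \<le> \<bar>a\<bar> * (4 / sqrt (real n))"
      using real_sqrt_abs[of 4] by (intro mult_left_mono) (auto simp: real_sqrt_divide)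
    moreover have "enn2real (?W n) \<le> \<bar>a\<bar> * sqrt (8 / (real n - 1))"
      using W[OF n] n by (intro enn2real_leI) auto
    ultimately show "norm (enn2real (?W n)) \<le> 4 * \<bar>a\<bar> * norm (1 / sqrt (real n))"
      by (simp add: mult.commute)
  qed
  with rate \<open>a \<noteq> 0\<close> show ?thesis
    by (intro conjI exI[of _ "5 / \<bar>a\<bar>"]) auto
qed

end
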